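(* For all $x, y \in \operatorname{dom}\psi$ and all $t \in [0,1]$, $$f(y) \;\ge\; f(x) + \langle \nabla f(x), y-x\rangle + \frac{t}{2}\langle \nabla^2 f(x)(y-x), y-x\rangle - \frac{t^{1+\nu} H_\nu \|y-x\|^{2+\nu}}{(1+\nu)(2+\nu)}.$$
   Context: $\psi:\mathbb{R}^n\to\mathbb{R}\cup\{+\infty\}$ is a proper closed convex function; $f$ is convex and twice continuously differentiable at every point of $\operatorname{dom}\psi=\{x:\psi(x)<+\infty\}$. $\langle\cdot,\cdot\rangle$ is the standard scalar product on $\mathbb{R}^n$ and $\|\cdot\|$ is an arbitrary fixed (possibly non-Euclidean) norm on $\mathbb{R}^n$, with dual norm $\|s\|_*=\sup_{\|h\|\le 1}\langle s,h\rangle$ and induced matrix norm $\|A\|=\sup_{\|h\|\le1}\|Ah\|_*$. The domain is bounded: $D:=\sup_{x,y\in\operatorname{dom}\psi}\|x-y\|<+\infty$. The Hessian of $f$ is Hölder continuous of degree $\nu\in[0,1]$ on $\operatorname{dom}\psi$ with constant $0\le H_\nu<+\infty$: $\|\nabla^2 f(x)-\nabla^2 f(y)\|\le H_\nu\|x-y\|^\nu$ for all $x,y\in\operatorname{dom}\psi$. *)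

theory Defs
  imports "HOL-Analysis.Analysis"
begin

section \<open>Extended-valued convex functions\<close>

definition eff_domain :: "(real^'n \<Rightarrow> ereal) \<Rightarrow> (real^'n) set" where
  "eff_domain \<psi> = {x. \<psi> x < \<infinity>}"

definition ereal_epigraph :: "(real^'n \<Rightarrow> ereal) \<Rightarrow> ((real^'n) \<times> real) set" where
  "ereal_epigraph \<psi> = {(x, r). \<psi> x \<le> ereal r}"

definition proper_closed_convex :: "(real^'n \<Rightarrow> ereal) \<Rightarrow> bool" where
  "proper_closed_convex \<psi> \<longleftrightarrow>
     (\<forall>x. \<psi> x \<noteq> -\<infinity>) \<and> eff_domain \<psi> \<noteq> {} \<and>
     closed (ereal_epigraph \<psi>) \<and> convex (ereal_epigraph \<psi>)"

section \<open>Arbitrary norms, dual norms and induced matrix norms\<close>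

definition is_norm :: "(real^'n \<Rightarrow> real) \<Rightarrow> bool" where
  "is_norm N \<longleftrightarrow>
     (\<forall>x. 0 \<le> N x) \<and> (\<forall>x. N x = 0 \<longleftrightarrow> x = 0) \<and>
     (\<forall>c x. N (c *\<^sub>R x) = \<bar>c\<bar> * N x) \<and> (\<forall>x y. N (x + y) \<le> N x + N y)"

text \<open>When \<open>N\<close> is a norm on this finite-dimensional space, both suprema below are over
  nonempty sets of reals that are bounded above.\<close>

definition dual_norm :: "(real^'n \<Rightarrow> real) \<Rightarrow> real^'n \<Rightarrow> real" where
  "dual_norm N s = (SUP h\<in>{h. N h \<le> 1}. s \<bullet> h)"

definition matrix_norm :: "(real^'n \<Rightarrow> real) \<Rightarrow> real^'n^'n \<Rightarrow> real" where
  "matrix_norm N A = (SUP h\<in>{h. N h \<le> 1}. dual_norm N (A *v h))"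

section \<open>Gradient and Hessian\<close>

definition gradient :: "(real^'n \<Rightarrow> real) \<Rightarrow> real^'n \<Rightarrow> real^'n" where
  "gradient f x = (THE g. GDERIV f x :> g)"

definition hessian :: "(real^'n \<Rightarrow> real) \<Rightarrow> real^'n \<Rightarrow> real^'n^'n" where
  "hessian f x = jacobian (gradient f) (at x)"

text \<open>The filter \<open>nhds x\<close> includes the point \<open>x\<close> itself, and the derivatives are full
  (not one-sided) ones, also when \<open>x\<close> is a boundary point of a set of interest.\<close>

definition twice_cont_diff_at :: "(real^'n \<Rightarrow> real) \<Rightarrow> real^'n \<Rightarrow> bool" where
  "twice_cont_diff_at f x \<longleftrightarrow>
     (\<forall>\<^sub>F z in nhds x. f differentiable (at z) \<and> gradient f differentiable (at z)) \<and>
     isCont (hessian f) x"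

text \<open>For \<open>\<nu> = 0\<close> and \<open>x = y\<close> the convention \<open>0 powr 0 = 0\<close> is harmless, since the
  left-hand side is then \<open>0\<close> as well.\<close>

definition hessian_hoelder_on ::
    "(real^'n \<Rightarrow> real) \<Rightarrow> (real^'n) set \<Rightarrow> (real^'n \<Rightarrow> real) \<Rightarrow> real \<Rightarrow> real \<Rightarrow> bool" where
  "hessian_hoelder_on N S f \<nu> H \<longleftrightarrow>
     (\<forall>x\<in>S. \<forall>y\<in>S. matrix_norm N (hessian f x - hessian f y) \<le> H * N (x - y) powr \<nu>)"

end

theory Submission
  imports Defs
begin

text \<open>
  Everything happens on the segment from \<open>x\<close> to \<open>y\<close>. Put \<open>h = y - x\<close> and
  \<open>g s = f (x + s h)\<close>, so that \<open>g' s\<close> is the gradient at \<open>x + s h\<close> paired with \<open>h\<close>, and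
  \<open>g'' s\<close> is the quadratic form of the Hessian there, evaluated at \<open>h\<close>.

  Any norm on a finite-dimensional space dominates a multiple of the Euclidean one, so the suprema
  that define the dual norm and the matrix norm are finite, and the induced norm controls the
  quadratic form: \<open>\<langle>A h, h\<rangle> \<le> \<parallel>A\<parallel> \<parallel>h\<parallel>\<^sup>2\<close> (\<open>quadratic_form_le_matrix_norm\<close>). Hence the Hoelder
  condition gives \<open>g'' s \<ge> g'' 0 - K s\<^sup>\<nu>\<close> with \<open>K = H \<parallel>h\<parallel>\<^sup>2\<^sup>+\<^sup>\<nu>\<close>, and integrating twice
  yields the Taylor bound (\<open>taylor2_lower_bound_powr\<close>)
  \<open>g t \<ge> g 0 + t g' 0 + t\<^sup>2/2 g'' 0 - K t\<^sup>2\<^sup>+\<^sup>\<nu> / ((1+\<nu>)(2+\<nu>))\<close>.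

  Convexity carries this bound from \<open>t\<close> to the end of the segment: the chord slope
  \<open>(g t - g 0) / t\<close> is at most \<open>g 1 - g 0\<close>. Dividing the Taylor bound by \<open>t\<close> therefore costs
  exactly one power of \<open>t\<close> in every term, which is the claim for \<open>t > 0\<close>; the case \<open>t = 0\<close>
  follows by letting \<open>t\<close> decrease to zero.
\<close>

section \<open>Norms on a finite-dimensional space\<close>

lemma is_norm_scaleR: "is_norm N \<Longrightarrow> N (c *\<^sub>R x) = \<bar>c\<bar> * N x"
  and is_norm_nonneg: "is_norm N \<Longrightarrow> 0 \<le> N x"
  and is_norm_eq_0_iff: "is_norm N \<Longrightarrow> N x = 0 \<longleftrightarrow> x = 0"
  and is_norm_triangle: "is_norm N \<Longrightarrow> N (x + y) \<le> N x + N y"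
  by (auto simp: is_norm_def)

lemma is_norm_zero: "is_norm N \<Longrightarrow> N 0 = 0"
  by (simp add: is_norm_eq_0_iff)

text \<open>A norm is convex, hence continuous in finite dimension, so it attains a positive minimum on
  the Euclidean unit sphere; homogeneity does the rest.\<close>

lemma is_norm_dominates_euclidean:
  fixes N :: "real^'n \<Rightarrow> real"
  assumes N: "is_norm N"
  obtains C where "0 < C" "\<And>x. norm x \<le> C * N x"
proof -
  have "convex_on UNIV N"
  proof (rule convex_onI)
    fix t :: real and x y :: "real^'n"
    assume t: "0 < t" "t < 1"
    have "N ((1 - t) *\<^sub>R x + t *\<^sub>R y) \<le> N ((1 - t) *\<^sub>R x) + N (t *\<^sub>R y)"
      by (rule is_norm_triangle[OF N])
    then show "N ((1 - t) *\<^sub>R x + t *\<^sub>R y) \<le> (1 - t) * N x + t * N y"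
      using t by (simp add: is_norm_scaleR[OF N])
  qed auto
  then have "continuous_on UNIV N"
    by (intro convex_on_continuous) auto
  then have cont: "continuous_on (sphere 0 1) N"
    using continuous_on_subset by blast
  have "axis undefined 1 \<in> sphere (0::real^'n) 1"
    by simp
  then obtain m where m: "m \<in> sphere 0 1" and min: "\<And>z. z \<in> sphere 0 1 \<Longrightarrow> N m \<le> N z"
    using continuous_attains_inf[OF _ _ cont] by (metis compact_sphere empty_iff)
  have "m \<noteq> 0"
    using m by auto
  then have pos: "0 < N m"
    using is_norm_nonneg[OF N, of m] is_norm_eq_0_iff[OF N, of m] by linarith
  have "norm x \<le> (1 / N m) * N x" for x
  proof (cases "x = 0")
    case True
    then show ?thesis
      using is_norm_zero[OF N] by simp
  next
    case False
    then have "N m \<le> N ((1 / norm x) *\<^sub>R x)"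
      by (intro min) simp
    also have "\<dots> = N x / norm x"
      by (simp add: is_norm_scaleR[OF N])
    finally show ?thesis
      using False pos by (simp add: field_simps)
  qed
  then show ?thesis
    using that[of "1 / N m"] pos by simp
qed

text \<open>These two boundedness facts are what makes the suprema in the dual and matrix norms upper
  bounds at all: a \<open>SUP\<close> over an unbounded set of reals carries no information.\<close>

lemma bdd_above_dual_norm:
  fixes N :: "real^'n \<Rightarrow> real"
  assumes "is_norm N"
  shows "bdd_above ((\<lambda>h. s \<bullet> h) ` {h. N h \<le> 1})"
proof -
  obtain C where C: "0 < C" "\<And>x. norm x \<le> C * N x"
    using is_norm_dominates_euclidean[OF assms] by blast
  have "s \<bullet> h \<le> norm s * C" if "N h \<le> 1" for h
  proof -
    have "norm h \<le> C"
      using order_trans[OF C(2) mult_left_le[OF that]] C(1) by simp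
    then show ?thesis
      using norm_cauchy_schwarz[of s h] mult_left_mono[of "norm h" C "norm s"] by simp
  qed
  then show ?thesis
    by (intro bdd_aboveI2) auto
qed

lemma bdd_above_matrix_norm:
  fixes N :: "real^'n \<Rightarrow> real" and A :: "real^'n^'n"
  assumes N: "is_norm N"
  shows "bdd_above ((\<lambda>h. dual_norm N (A *v h)) ` {h. N h \<le> 1})"
proof -
  obtain C where C: "0 < C" "\<And>x. norm x \<le> C * N x"
    using is_norm_dominates_euclidean[OF N] by blast
  have ball: "norm h \<le> C" if "N h \<le> 1" for h
    using order_trans[OF C(2) mult_left_le[OF that]] C(1) by simp
  obtain B where B: "0 < B" "\<And>x. norm (A *v x) \<le> norm x * B"
    using bounded_linear.pos_bounded[OF matrix_vector_mul_bounded_linear[of A]] by auto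
  have "dual_norm N (A *v h) \<le> C * B * C" if h: "N h \<le> 1" for h
    unfolding dual_norm_def
  proof (rule cSUP_least)
    show "{h. N h \<le> 1} \<noteq> {}"
      using is_norm_zero[OF N] by (metis empty_iff mem_Collect_eq zero_le_one)
    fix k assume "k \<in> {h. N h \<le> 1}"
    then have k: "norm k \<le> C"
      by (simp add: ball)
    have "norm (A *v h) \<le> C * B"
      using order_trans[OF B(2) mult_right_mono[OF ball[OF h]]] B(1) by simp
    then have "norm (A *v h) * norm k \<le> C * B * C"
      using k by (intro mult_mono) (use B C in auto)
    then show "(A *v h) \<bullet> k \<le> C * B * C"
      using norm_cauchy_schwarz[of "A *v h" k] by simp
  qed
  then show ?thesis
    by (intro bdd_aboveI2) auto
qed

text \<open>By homogeneity it suffices to test the unit vector \<open>u = h / \<parallel>h\<parallel>\<close>, which is admissible in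
  both suprema.\<close>

lemma quadratic_form_le_matrix_norm:
  fixes N :: "real^'n \<Rightarrow> real" and A :: "real^'n^'n"
  assumes N: "is_norm N"
  shows "(A *v h) \<bullet> h \<le> matrix_norm N A * (N h)\<^sup>2"
proof (cases "h = 0")
  case True
  then show ?thesis
    using is_norm_zero[OF N] by simp
next
  case False
  then have pos: "0 < N h"
    using is_norm_nonneg[OF N, of h] is_norm_eq_0_iff[OF N, of h] by linarith
  define u where "u = (1 / N h) *\<^sub>R h"
  have u: "N u \<le> 1" and h: "h = N h *\<^sub>R u"
    using pos by (simp_all add: u_def is_norm_scaleR[OF N])
  have "(A *v u) \<bullet> u \<le> dual_norm N (A *v u)"
    unfolding dual_norm_def using u by (intro cSUP_upper bdd_above_dual_norm[OF N]) simp
  also have "\<dots> \<le> matrix_norm N A"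
    unfolding matrix_norm_def using u by (intro cSUP_upper bdd_above_matrix_norm[OF N]) simp
  finally have "(N h)\<^sup>2 * ((A *v u) \<bullet> u) \<le> (N h)\<^sup>2 * matrix_norm N A"
    by (intro mult_left_mono) auto
  moreover have "(A *v h) \<bullet> h = (N h)\<^sup>2 * ((A *v u) \<bullet> u)"
    by (subst (1 2) h) (simp add: matrix_vector_mult_scaleR power2_eq_square)
  ultimately show ?thesis
    by (simp add: mult.commute)
qed

section \<open>Derivatives along a segment\<close>

text \<open>The Riesz representation of the derivative shows that the definite description in
  \<^const>\<open>gradient\<close> is not vacuous.\<close>

lemma differentiable_imp_has_derivative_gradient:
  fixes f :: "real^'n \<Rightarrow> real"
  assumes "f differentiable (at x)"
  shows "(f has_derivative (\<lambda>h. gradient f x \<bullet> h)) (at x)"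
proof -
  obtain L where L: "(f has_derivative L) (at x)"
    using assms by (auto simp: differentiable_def)
  have "linear L"
    using L by (rule has_derivative_linear)
  have L_eq: "L = (\<lambda>h. h \<bullet> adjoint L 1)"
  proof
    show "L h = h \<bullet> adjoint L 1" for h
      using adjoint_works[OF \<open>linear L\<close>, of h 1] by simp
  qed
  have G: "GDERIV f x :> adjoint L 1"
    unfolding gderiv_def by (rule back_subst[of "\<lambda>L. (f has_derivative L) (at x)", OF L L_eq])
  have "g = adjoint L 1" if "GDERIV f x :> g" for g
  proof -
    have "(\<lambda>h. h \<bullet> g) = (\<lambda>h. h \<bullet> adjoint L 1)"
      using that G unfolding gderiv_def by (rule has_derivative_unique)
    then have "\<forall>h. h \<bullet> g = h \<bullet> adjoint L 1"
      by (simp add: fun_eq_iff)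
    then show ?thesis
      by (simp only: vector_eq_ldot)
  qed
  with G have "gradient f x = adjoint L 1"
    unfolding gradient_def by (rule the_equality)
  then show ?thesis
    using G by (simp add: gderiv_def inner_commute)
qed

lemma has_derivative_along_line:
  fixes F :: "real^'n \<Rightarrow> 'b::real_normed_vector"
  assumes "(F has_derivative L) (at (x + s *\<^sub>R h))"
  shows "((\<lambda>s. F (x + s *\<^sub>R h)) has_derivative (\<lambda>r. L (r *\<^sub>R h))) (at s)"
proof -
  have "((\<lambda>s. x + s *\<^sub>R h) has_derivative (\<lambda>r. r *\<^sub>R h)) (at s)"
    by (auto intro!: derivative_eq_intros)
  from has_derivative_compose[OF this assms] show ?thesis .
qed

lemma twice_cont_diff_at_along_line:
  fixes f :: "real^'n \<Rightarrow> real"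
  assumes "twice_cont_diff_at f (x + s *\<^sub>R h)"
  shows "((\<lambda>s. f (x + s *\<^sub>R h)) has_real_derivative gradient f (x + s *\<^sub>R h) \<bullet> h) (at s)"
    and "((\<lambda>s. gradient f (x + s *\<^sub>R h) \<bullet> h) has_real_derivative
           (hessian f (x + s *\<^sub>R h) *v h) \<bullet> h) (at s)"
proof -
  let ?z = "x + s *\<^sub>R h"
  have f: "f differentiable (at ?z)" and grad: "gradient f differentiable (at ?z)"
    using assms eventually_nhds_x_imp_x unfolding twice_cont_diff_at_def by fastforce+
  show "((\<lambda>s. f (x + s *\<^sub>R h)) has_real_derivative gradient f ?z \<bullet> h) (at s)"
    using has_derivative_along_line[OF differentiable_imp_has_derivative_gradient[OF f]]
    by (simp add: has_field_derivative_def mult_commute_abs)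
  have "(gradient f has_derivative (\<lambda>k. hessian f ?z *v k)) (at ?z)"
    using grad by (simp add: hessian_def jacobian_works)
  from has_derivative_inner_left[OF has_derivative_along_line[OF this], of h]
  show "((\<lambda>s. gradient f (x + s *\<^sub>R h) \<bullet> h) has_real_derivative (hessian f ?z *v h) \<bullet> h) (at s)"
    by (simp add: has_field_derivative_def matrix_vector_mult_scaleR mult_commute_abs)
qed

section \<open>The one-dimensional estimate\<close>

text \<open>The error term is the double primitive of \<open>K s powr \<nu>\<close>. Adding it to \<open>g\<close> minus its
  first- and second-order Taylor terms gives a function \<open>w\<close> with \<open>w 0 = g 0\<close>, \<open>w' 0 = 0\<close> and
  \<open>w'' \<ge> 0\<close> inside the interval, so \<open>w'\<close> is nonnegative and \<open>w 0 \<le> w t\<close>. Monotonicity is read off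
  from derivatives in the open interval and continuity on the closed one, so the powers are never
  differentiated at the singular point \<open>0\<close>.\<close>

lemma taylor2_lower_bound_powr:
  fixes g g1 g2 :: "real \<Rightarrow> real"
  assumes g: "\<And>s. 0 \<le> s \<Longrightarrow> s \<le> t \<Longrightarrow> (g has_real_derivative g1 s) (at s)"
    and g1: "\<And>s. 0 \<le> s \<Longrightarrow> s \<le> t \<Longrightarrow> (g1 has_real_derivative g2 s) (at s)"
    and g2: "\<And>s. 0 < s \<Longrightarrow> s < t \<Longrightarrow> g2 0 - K * s powr \<nu> \<le> g2 s"
    and "0 \<le> t" "0 \<le> \<nu>"
  shows "g 0 + t * g1 0 + t\<^sup>2 / 2 * g2 0 - K * t powr (2 + \<nu>) / ((1 + \<nu>) * (2 + \<nu>)) \<le> g t"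
proof -
  define w1 where "w1 s = g1 s - g1 0 - s * g2 0 + K * s powr (1 + \<nu>) / (1 + \<nu>)" for s
  define w where "w s = g s - s * g1 0 - s\<^sup>2 / 2 * g2 0
      + K * s powr (2 + \<nu>) / ((1 + \<nu>) * (2 + \<nu>))" for s
  have cont_g: "continuous_on {0..t} g" and cont_g1: "continuous_on {0..t} g1"
    using g g1 by (meson DERIV_atLeastAtMost_imp_continuous_on)+
  have w1': "(w1 has_real_derivative g2 s - g2 0 + K * s powr \<nu>) (at s)"
    if "0 < s" "s < t" for s
  proof -
    have "1 + \<nu> \<noteq> 0"
      using \<open>0 \<le> \<nu>\<close> by simp
    then show ?thesis
      unfolding w1_def using that by (auto intro!: derivative_eq_intros g1)
  qed
  have w': "(w has_real_derivative w1 s) (at s)" if "0 < s" "s < t" for s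
  proof -
    have "((\<lambda>s. K * s powr (2 + \<nu>) / ((1 + \<nu>) * (2 + \<nu>))) has_real_derivative
        (K * s powr (1 + \<nu>)) * (2 + \<nu>) / ((1 + \<nu>) * (2 + \<nu>))) (at s)"
      using that \<open>0 \<le> \<nu>\<close> by (auto intro!: derivative_eq_intros)
    also have "(K * s powr (1 + \<nu>)) * (2 + \<nu>) / ((1 + \<nu>) * (2 + \<nu>)) = K * s powr (1 + \<nu>) / (1 + \<nu>)"
      using \<open>0 \<le> \<nu>\<close> by (intro mult_divide_mult_cancel_right) simp
    finally have error: "((\<lambda>s. K * s powr (2 + \<nu>) / ((1 + \<nu>) * (2 + \<nu>))) has_real_derivative
        K * s powr (1 + \<nu>) / (1 + \<nu>)) (at s)" .
    have "((\<lambda>s. g s - s * g1 0 - s\<^sup>2 / 2 * g2 0) has_real_derivative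
        g1 s - g1 0 - s * g2 0) (at s)"
      using that by (auto intro!: derivative_eq_intros g)
    from DERIV_add[OF this error] show ?thesis
      unfolding w_def w1_def .
  qed
  have w1_nonneg: "0 \<le> w1 s" if "0 < s" "s < t" for s
  proof -
    have "w1 0 \<le> w1 s"
    proof (rule DERIV_nonneg_imp_increasing_open[of 0 s w1])
      show "\<exists>y. (w1 has_real_derivative y) (at r) \<and> 0 \<le> y" if "0 < r" "r < s" for r
        using w1'[of r] g2[of r] that \<open>s < t\<close> by (intro exI conjI) auto
      show "continuous_on {0..s} w1"
        unfolding w1_def using \<open>0 \<le> \<nu>\<close> \<open>s < t\<close>
        by (intro continuous_intros continuous_on_powr' continuous_on_subset[OF cont_g1]) auto
    qed (use \<open>0 < s\<close> in simp)
    then show ?thesis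
      by (simp add: w1_def)
  qed
  have "w 0 \<le> w t"
  proof (rule DERIV_nonneg_imp_increasing_open[of 0 t w])
    show "\<exists>y. (w has_real_derivative y) (at r) \<and> 0 \<le> y" if "0 < r" "r < t" for r
      using w' w1_nonneg that by blast
    show "continuous_on {0..t} w"
      unfolding w_def using \<open>0 \<le> \<nu>\<close> by (intro continuous_intros continuous_on_powr' cont_g) auto
  qed fact
  then show ?thesis
    by (simp add: w_def)
qed

text \<open>The chord inequality turns a lower bound on \<open>g t\<close> into one on \<open>g 1\<close>, divided by \<open>t\<close>. At
  \<open>t = 0\<close> the bound is inherited from positive \<open>t\<close> because its right-hand side is continuous
  there.\<close>

lemma convex_taylor2_lower_bound_powr:
  fixes g g1 g2 :: "real \<Rightarrow> real"
  assumes conv: "convex_on {0..1} g"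
    and g: "\<And>s. 0 \<le> s \<Longrightarrow> s \<le> 1 \<Longrightarrow> (g has_real_derivative g1 s) (at s)"
    and g1: "\<And>s. 0 \<le> s \<Longrightarrow> s \<le> 1 \<Longrightarrow> (g1 has_real_derivative g2 s) (at s)"
    and g2: "\<And>s. 0 < s \<Longrightarrow> s < 1 \<Longrightarrow> g2 0 - K * s powr \<nu> \<le> g2 s"
    and "0 \<le> \<nu>" and t: "0 \<le> t" "t \<le> 1"
  shows "g 0 + g1 0 + t / 2 * g2 0 - t powr (1 + \<nu>) * K / ((1 + \<nu>) * (2 + \<nu>)) \<le> g 1"
proof -
  define R where "R t = g 0 + g1 0 + t / 2 * g2 0 - t powr (1 + \<nu>) * K / ((1 + \<nu>) * (2 + \<nu>))" for t
  have pos: "R t \<le> g 1" if t: "0 < t" "t \<le> 1" for t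
  proof -
    have powr: "t powr (2 + \<nu>) = t * t powr (1 + \<nu>)"
      using t powr_add[of t 1 "1 + \<nu>"] by simp
    have "g 0 + t * g1 0 + t\<^sup>2 / 2 * g2 0 - K * t powr (2 + \<nu>) / ((1 + \<nu>) * (2 + \<nu>)) \<le> g t"
      using t \<open>0 \<le> \<nu>\<close> by (intro taylor2_lower_bound_powr g g1 g2) auto
    also have "g t \<le> (1 - t) * g 0 + t * g 1"
      using convex_onD[OF conv, of t 0 1] t by simp
    finally have "t * R t \<le> t * g 1"
      unfolding R_def powr by (simp add: algebra_simps power2_eq_square)
    then show ?thesis
      using t by simp
  qed
  have "R t \<le> g 1"
  proof (cases "t = 0")
    case True
    have "continuous_on {0..1} R"
      unfolding R_def using \<open>0 \<le> \<nu>\<close> by (intro continuous_intros continuous_on_powr') auto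
    then have "(R \<longlongrightarrow> R 0) (at 0 within {0..1})"
      by (simp add: continuous_on_def)
    then have "(R \<longlongrightarrow> R 0) (at_right 0)"
      by (simp add: at_within_Icc_at_right)
    moreover have "\<forall>\<^sub>F t in at_right 0. R t \<le> g 1"
      unfolding eventually_at_right_field using pos by (intro exI[of _ 1]) auto
    ultimately show ?thesis
      using True by (metis tendsto_upperbound trivial_limit_at_right_real)
  qed (use pos t in auto)
  then show ?thesis
    by (simp add: R_def)
qed

lemma convex_on_along_segment:
  fixes f :: "'a::real_vector \<Rightarrow> real"
  assumes f: "convex_on S f" and "x \<in> S" "x + h \<in> S"
  shows "convex_on {0..1::real} (\<lambda>s. f (x + s *\<^sub>R h))"
    and "\<And>s. 0 \<le> s \<Longrightarrow> s \<le> 1 \<Longrightarrow> x + s *\<^sub>R h \<in> S"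
proof -
  have S: "x + s *\<^sub>R h \<in> S" if "0 \<le> s" "s \<le> 1" for s
    using convexD_alt[OF convex_on_imp_convex[OF f] assms(2,3) that] by (simp add: algebra_simps)
  then show "\<And>s. 0 \<le> s \<Longrightarrow> s \<le> 1 \<Longrightarrow> x + s *\<^sub>R h \<in> S" .
  show "convex_on {0..1::real} (\<lambda>s. f (x + s *\<^sub>R h))"
  proof (rule convex_onI)
    fix t a b :: real
    assume "0 < t" "t < 1" "a \<in> {0..1}" "b \<in> {0..1}"
    then have "f ((1 - t) *\<^sub>R (x + a *\<^sub>R h) + t *\<^sub>R (x + b *\<^sub>R h))
        \<le> (1 - t) * f (x + a *\<^sub>R h) + t * f (x + b *\<^sub>R h)"
      by (intro convex_onD[OF f] S) auto
    then show "f (x + ((1 - t) *\<^sub>R a + t *\<^sub>R b) *\<^sub>R h)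
        \<le> (1 - t) * f (x + a *\<^sub>R h) + t * f (x + b *\<^sub>R h)"
      by (simp add: algebra_simps)
  qed simp
qed

section \<open>The lower bound under a Hoelder continuous Hessian\<close>

text \<open>Of the exponent \<open>2 + \<nu>\<close>, the \<open>2\<close> comes from the quadratic form and the \<open>\<nu>\<close> from the
  distance \<open>s \<parallel>h\<parallel>\<close> between the two points.\<close>

lemma hessian_hoelder_on_quadratic_form:
  fixes f N :: "real^'n \<Rightarrow> real"
  assumes N: "is_norm N" and hoelder: "hessian_hoelder_on N S f \<nu> H"
    and "x \<in> S" "x + s *\<^sub>R h \<in> S" "0 \<le> s"
  shows "(hessian f x *v h) \<bullet> h - H * N h powr (2 + \<nu>) * s powr \<nu>
           \<le> (hessian f (x + s *\<^sub>R h) *v h) \<bullet> h"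
proof -
  let ?A = "hessian f x - hessian f (x + s *\<^sub>R h)"
  have "N (x - (x + s *\<^sub>R h)) = s * N h"
    using is_norm_scaleR[OF N, of "- s" h] \<open>0 \<le> s\<close> by simp
  then have "matrix_norm N ?A \<le> H * (s * N h) powr \<nu>"
    using hoelder assms(3,4) unfolding hessian_hoelder_on_def by metis
  then have "matrix_norm N ?A * (N h)\<^sup>2 \<le> H * (s * N h) powr \<nu> * (N h)\<^sup>2"
    by (intro mult_right_mono) auto
  also have "\<dots> = H * N h powr (2 + \<nu>) * s powr \<nu>"
    using is_norm_nonneg[OF N, of h] \<open>0 \<le> s\<close>
    by (cases "N h = 0") (simp_all add: powr_mult powr_add)
  finally have "(?A *v h) \<bullet> h \<le> H * N h powr (2 + \<nu>) * s powr \<nu>"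
    using quadratic_form_le_matrix_norm[OF N, of ?A h] by linarith
  then show ?thesis
    by (simp add: matrix_vector_mult_diff_rdistrib inner_diff_left)
qed

theorem lemma1:
  fixes \<psi> :: "real^'n \<Rightarrow> ereal"
    and f :: "real^'n \<Rightarrow> real"
    and N :: "real^'n \<Rightarrow> real"
    and \<nu> H :: real
  assumes "proper_closed_convex \<psi>"
    and "convex_on (eff_domain \<psi>) f"
    and "\<And>z. z \<in> eff_domain \<psi> \<Longrightarrow> twice_cont_diff_at f z"
    and "is_norm N"
    and "(SUP (u, v)\<in>eff_domain \<psi> \<times> eff_domain \<psi>. ereal (N (u - v))) < \<infinity>"
    and "0 \<le> \<nu>" and "\<nu> \<le> 1"
    and "0 \<le> H"
    and "hessian_hoelder_on N (eff_domain \<psi>) f \<nu> H"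
  shows "\<forall>x\<in>eff_domain \<psi>. \<forall>y\<in>eff_domain \<psi>. \<forall>t\<in>{0..1}.
     f y \<ge> f x + gradient f x \<bullet> (y - x)
            + t / 2 * ((hessian f x *v (y - x)) \<bullet> (y - x))
            - t powr (1 + \<nu>) * H * N (y - x) powr (2 + \<nu>) / ((1 + \<nu>) * (2 + \<nu>))"
proof (intro ballI)
  fix x y and t :: real
  assume x: "x \<in> eff_domain \<psi>" and y: "y \<in> eff_domain \<psi>" and t: "t \<in> {0..1}"
  define h where "h = y - x"
  have "x + h \<in> eff_domain \<psi>"
    using y by (simp add: h_def)
  note segment = convex_on_along_segment[OF assms(2) x this]
  note deriv = twice_cont_diff_at_along_line[OF assms(3)[OF segment(2)]]
  have "f (x + 0 *\<^sub>R h) + gradient f (x + 0 *\<^sub>R h) \<bullet> h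
      + t / 2 * ((hessian f (x + 0 *\<^sub>R h) *v h) \<bullet> h)
      - t powr (1 + \<nu>) * (H * N h powr (2 + \<nu>)) / ((1 + \<nu>) * (2 + \<nu>)) \<le> f (x + 1 *\<^sub>R h)"
  proof (rule convex_taylor2_lower_bound_powr[OF segment(1) deriv])
    show "(hessian f (x + 0 *\<^sub>R h) *v h) \<bullet> h - H * N h powr (2 + \<nu>) * s powr \<nu>
        \<le> (hessian f (x + s *\<^sub>R h) *v h) \<bullet> h" if "0 < s" "s < 1" for s
      using hessian_hoelder_on_quadratic_form[OF assms(4,9) x segment(2)] that by simp
  qed (use t \<open>0 \<le> \<nu>\<close> in auto)
  then show "f y \<ge> f x + gradient f x \<bullet> (y - x)
            + t / 2 * ((hessian f x *v (y - x)) \<bullet> (y - x))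
            - t powr (1 + \<nu>) * H * N (y - x) powr (2 + \<nu>) / ((1 + \<nu>) * (2 + \<nu>))"
    by (simp add: h_def mult.assoc)
qed

end
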